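(* Let $\eta>0$ be real, let $\mathcal{A}_1,\mathcal{A}_2,\mathcal{A}_3>0$ be real, and let $p_x,p_y,p_z\ge 0$ be integers. Let $\vec{\mathbf R}=(R_x,R_y,R_z)\in\mathbb{R}^3$. For $\mu\in\{1,2,3\}$, let $\vec{\mathbf k}\in\mathbb{R}^3$ be a vector of the reciprocal lattice, so that $\vec{\mathbf k}=(k_x,0,0)$ if $\mu=1$, $\vec{\mathbf k}=(k_x,k_y,0)$ if $\mu=2$, and $\vec{\mathbf k}=(k_x,k_y,k_z)$ if $\mu=3$. Let $\alpha$ be one of $\sqrt{|\vec{\mathbf k}|^2-\kappa^2}$, $\sqrt{|\vec{\mathbf k}|^2+\kappa^2}$ (with $\kappa>0$ real) or $|\vec{\mathbf k}|$, and assume $\alpha\neq 0$. Define $\mathcal{E}_k^{(\mu)}(\vec{\mathbf R},\vec{\mathbf k})$ by $$\mathcal{E}_k^{(1)}=\frac{e^{ik_xR_x}}{4\pi\mathcal{A}_1}\sum_{q=0}^{\infty}\frac{(-1)^q}{q!}\left(\eta\sqrt{R_y^2+R_z^2}\right)^{2q}E_{1+q}\!\left(\frac{\alpha^2}{4\eta^2}\right),$$ $$\mathcal{E}_k^{(2)}=\frac{e^{i(k_xR_x+k_yR_y)}}{4\mathcal{A}_2\alpha}\sum_{\pm}e^{\pm\alpha|R_z|}\,\mathrm{erfc}\!\left(\frac{\alpha}{2\eta}\pm\eta|R_z|\right),\qquad \mathcal{E}_k^{(3)}=\frac{e^{i\vec{\mathbf k}\cdot\vec{\mathbf R}-\alpha^2/4\eta^2}}{\mathcal{A}_3\alpha^2}.$$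 Then the partial derivatives with respect to the components of $\vec{\mathbf R}$ are as follows. (a) For $\mu=1$, $$\partial_x^{p_x}\partial_y^{p_y}\partial_z^{p_z}\mathcal{E}_k^{(1)}=(ik_x)^{p_x}\frac{e^{ik_xR_x}}{4\pi\mathcal{A}_1}\sum_{q=0}^{\infty}\frac{(-\eta^2)^q}{q!}E_{1+q}\!\left(\frac{\alpha^2}{4\eta^2}\right)\sum_{\substack{0\le m\le q\\ 2q-2m-p_y\ge 0\\ 2m-p_z\ge 0}}\binom{q}{m}\frac{(2q-2m)!\,(2m)!}{(2q-2m-p_y)!\,(2m-p_z)!}R_y^{2q-2m-p_y}R_z^{2m-p_z}.$$ (b) For $\mu=2$, $$\partial_x^{p_x}\partial_y^{p_y}\partial_z^{p_z}\mathcal{E}_k^{(2)}=(ik_x)^{p_x}(ik_y)^{p_y}\frac{e^{i(k_xR_x+k_yR_y)}}{4\mathcal{A}_2\alpha}\sum_{\pm}(\pm1)^{p_z}\Bigg(\sum_{m=1}^{p_z}\binom{p_z}{m}\frac{(-\eta)^m}{\alpha^{m-p_z}}\frac{2}{\sqrt{\pi}}H_{m-1}\!\left(\frac{\alpha}{2\eta}\pm\eta R_z\right)e^{-\frac{\alpha^2}{4\eta^2}-\eta^2R_z^2}+\alpha^{p_z}e^{\pm\alpha R_z}\,\mathrm{erfc}\!\left(\frac{\alpha}{2\eta}\pm\eta R_z\right)\Bigg).$$ (c) For $\mu=3$, $$\partial_x^{p_x}\partial_y^{p_y}\partial_z^{p_z}\mathcal{E}_k^{(3)}=(ik_x)^{p_x}(ik_y)^{p_y}(ik_z)^{p_z}\,\frac{e^{i\vec{\mathbf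 k}\cdot\vec{\mathbf R}-\alpha^2/4\eta^2}}{\mathcal{A}_3\alpha^2}.$$
   Context: $E_n$ is the exponential integral of order $n$: $E_n(z)=\int_1^\infty e^{-zt}t^{-n}\,dt$ for $\mathrm{Re}\,z>0$, extended by analytic continuation; when $\alpha^2<0$ the values $E_n(\alpha^2/4\eta^2)$ are taken from one fixed branch (e.g. the principal one), and when $\alpha$ is a square root of a negative number one fixed choice of the root is used throughout. $\mathrm{erfc}(z)=1-\frac{2}{\sqrt{\pi}}\int_0^z e^{-t^2}\,dt$ is the complementary error function (entire on $\mathbb{C}$). $H_n(u)=(-1)^ne^{u^2}\frac{d^n}{du^n}e^{-u^2}$ is the physicists' Hermite polynomial. $\sum_{\pm}$ denotes the sum of the two terms obtained by taking all upper signs, respectively all lower signs. The convention $0^0=1$ is used, and an empty sum is $0$. The three choices of $\alpha$ correspond to the Helmholtz, Yukawa and Poisson (Coulomb) equations respectively; $\mathcal{A}_\mu$ is the measure (length, area, volume) of the primitive cell of a $\mu$-dimensional orthorhombic lattice, lying along the $x$-axis for $\mu=1$ and in the $xy$-plane for $\mu=2$; and the functions $\mathcal{E}_k^{(\mu)}$ are the terms of the reciprocal-space sum in the Ewald representation of the periodic Green's function, with splitting parameter $\eta$. *)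

theory Defs
  imports "HOL-Complex_Analysis.Complex_Analysis"
begin

no_notation fps_nth (infixl "$" 75)

definition expint_integral :: "nat \<Rightarrow> complex \<Rightarrow> complex" where
  "expint_integral n z = integral {1..} (\<lambda>t. exp (- z * of_real t) / of_real t ^ n)"

text \<open>
  The germ of \<open>E\<^sub>n\<close> on the right half-plane continues analytically along every path in the
  punctured plane.  Expressed in the coordinate \<open>w = log z\<close> of the Riemann surface of the logarithm,
  the continuation is the unique entire function agreeing with the integral on the strip
  \<open>\<bar>Im w\<bar> < \<pi>/2\<close>, which \<open>exp\<close> maps bijectively onto the right half-plane.
\<close>

definition expint_lift :: "nat \<Rightarrow> complex \<Rightarrow> complex" where
  "expint_lift n = (THE F. F holomorphic_on UNIV \<and>
     (\<forall>w. \<bar>Im w\<bar> < pi / 2 \<longrightarrow> F w = expint_integral n (exp w)))"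

text \<open>
  The integer \<open>b\<close> selects the branch outside the right half-plane; \<open>b = 0\<close> is the principal branch
  (continuous from above on the negative real axis), \<open>b = -1\<close> its counterpart from below there.
\<close>

definition expint :: "int \<Rightarrow> nat \<Rightarrow> complex \<Rightarrow> complex" where
  "expint b n z = (if Re z > 0 then expint_integral n z
                   else expint_lift n (Ln z + 2 * of_int b * of_real pi * \<i>))"

definition erfc :: "complex \<Rightarrow> complex" where
  "erfc z = 1 - 2 / of_real (sqrt pi) * contour_integral (linepath 0 z) (\<lambda>t. exp (- (t\<^sup>2)))"

definition hermite :: "nat \<Rightarrow> complex \<Rightarrow> complex" where
  "hermite n u = (-1) ^ n * exp (u\<^sup>2) * (deriv ^^ n) (\<lambda>v. exp (- (v\<^sup>2))) u"

definition reciprocal_lattice :: "nat \<Rightarrow> real^3 \<Rightarrow> (real^3) set" where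
  "reciprocal_lattice \<mu> L = {k. \<exists>n\<^sub>x n\<^sub>y n\<^sub>z :: int.
      k $ 1 = (if \<mu> \<ge> 1 then 2 * pi * of_int n\<^sub>x / L $ 1 else 0) \<and>
      k $ 2 = (if \<mu> \<ge> 2 then 2 * pi * of_int n\<^sub>y / L $ 2 else 0) \<and>
      k $ 3 = (if \<mu> \<ge> 3 then 2 * pi * of_int n\<^sub>z / L $ 3 else 0)}"

text \<open>For a negative radicand either of the two complex roots is admitted.\<close>

definition is_square_root :: "real \<Rightarrow> complex \<Rightarrow> bool" where
  "is_square_root r \<alpha> \<longleftrightarrow> (if r \<ge> 0 then \<alpha> = of_real (sqrt r) else \<alpha>\<^sup>2 = of_real r)"

definition ewald_alpha :: "real^3 \<Rightarrow> complex \<Rightarrow> bool" where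
  "ewald_alpha k \<alpha> \<longleftrightarrow>
     (\<exists>\<kappa>>0. is_square_root ((norm k)\<^sup>2 - \<kappa>\<^sup>2) \<alpha>) \<or>
     (\<exists>\<kappa>>0. is_square_root ((norm k)\<^sup>2 + \<kappa>\<^sup>2) \<alpha>) \<or>
     \<alpha> = of_real (norm k)"

definition ewald1_term :: "int \<Rightarrow> real \<Rightarrow> complex \<Rightarrow> real^3 \<Rightarrow> nat \<Rightarrow> complex" where
  "ewald1_term b \<eta> \<alpha> R q =
     (-1) ^ q / fact q * of_real ((\<eta> * sqrt ((R $ 2)\<^sup>2 + (R $ 3)\<^sup>2)) ^ (2 * q)) *
     expint b (1 + q) (\<alpha>\<^sup>2 / of_real (4 * \<eta>\<^sup>2))"

definition ewald1 :: "int \<Rightarrow> real \<Rightarrow> real \<Rightarrow> complex \<Rightarrow> real^3 \<Rightarrow> real^3 \<Rightarrow> complex" where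
  "ewald1 b \<eta> A \<alpha> k R =
     exp (\<i> * of_real (k $ 1 * R $ 1)) / of_real (4 * pi * A) * (\<Sum>q. ewald1_term b \<eta> \<alpha> R q)"

text \<open>In sums over \<open>{1, -1}\<close> the index \<open>s\<close> is the sign written as a plus-minus.\<close>

definition ewald2 :: "real \<Rightarrow> real \<Rightarrow> complex \<Rightarrow> real^3 \<Rightarrow> real^3 \<Rightarrow> complex" where
  "ewald2 \<eta> A \<alpha> k R =
     exp (\<i> * of_real (k $ 1 * R $ 1 + k $ 2 * R $ 2)) / (4 * of_real A * \<alpha>) *
     (\<Sum>s\<in>{1, -1}. exp (s * \<alpha> * of_real \<bar>R $ 3\<bar>) *
        erfc (\<alpha> / of_real (2 * \<eta>) + s * of_real (\<eta> * \<bar>R $ 3\<bar>)))"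

definition ewald3 :: "real \<Rightarrow> real \<Rightarrow> complex \<Rightarrow> real^3 \<Rightarrow> real^3 \<Rightarrow> complex" where
  "ewald3 \<eta> A \<alpha> k R =
     exp (\<i> * of_real (k \<bullet> R) - \<alpha>\<^sup>2 / of_real (4 * \<eta>\<^sup>2)) / (of_real A * \<alpha>\<^sup>2)"

text \<open>
  Partial derivatives are relations, so that stating the value of a derivative includes its
  existence at every point.  Each relation is single-valued, hence so are its iterates, and
  \<open>has_partial_derivs p\<^sub>x p\<^sub>y p\<^sub>z f g\<close> determines \<open>g\<close>.
\<close>

definition has_partial :: "3 \<Rightarrow> (real^3 \<Rightarrow> complex) \<Rightarrow> (real^3 \<Rightarrow> complex) \<Rightarrow> bool" where
  "has_partial i f g \<longleftrightarrow>
     (\<forall>R. ((\<lambda>t. f (R + t *\<^sub>R axis i 1)) has_vector_derivative g R) (at 0))"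

definition has_partial_derivs ::
    "nat \<Rightarrow> nat \<Rightarrow> nat \<Rightarrow> (real^3 \<Rightarrow> complex) \<Rightarrow> (real^3 \<Rightarrow> complex) \<Rightarrow> bool" where
  "has_partial_derivs p\<^sub>x p\<^sub>y p\<^sub>z =
     (has_partial 3 ^^ p\<^sub>z) OO (has_partial 2 ^^ p\<^sub>y) OO (has_partial 1 ^^ p\<^sub>x)"

definition ewald1_deriv_term ::
    "int \<Rightarrow> real \<Rightarrow> complex \<Rightarrow> nat \<Rightarrow> nat \<Rightarrow> real^3 \<Rightarrow> nat \<Rightarrow> complex" where
  "ewald1_deriv_term b \<eta> \<alpha> p\<^sub>y p\<^sub>z R q =
     of_real ((- (\<eta>\<^sup>2)) ^ q / fact q) * expint b (1 + q) (\<alpha>\<^sup>2 / of_real (4 * \<eta>\<^sup>2)) *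
     of_real (\<Sum>m | m \<le> q \<and> p\<^sub>y \<le> 2 * q - 2 * m \<and> p\<^sub>z \<le> 2 * m.
        real (q choose m) * (fact (2 * q - 2 * m) * fact (2 * m)) /
          (fact (2 * q - 2 * m - p\<^sub>y) * fact (2 * m - p\<^sub>z)) *
        (R $ 2) ^ (2 * q - 2 * m - p\<^sub>y) * (R $ 3) ^ (2 * m - p\<^sub>z))"

end

theory Submission
  imports Defs
begin

text \<open>
  (a) The recurrence \<open>n E\<^sub>n\<^sub>+\<^sub>1(z) = exp (-z) - z E\<^sub>n(z)\<close> survives analytic continuation, so on every branch
  \<open>E\<^sub>1\<^sub>+\<^sub>q(z)\<close> grows at most geometrically in \<open>q\<close>.  Because of the factor \<open>1/q!\<close> the reciprocal-space
  series and all its formal derivatives converge locally uniformly for complex \<open>R\<^sub>y\<close> and \<open>R\<^sub>z\<close>, and it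
  may be differentiated term by term.

  (b) The Leibniz rule applied to \<open>exp (\<plusminus>\<alpha>z) erfc (\<alpha>/2\<eta> \<plusminus> \<eta>z)\<close>: the derivatives of \<open>erfc\<close> are Hermite
  polynomials times a Gaussian, and the product of that Gaussian with \<open>exp (\<plusminus>\<alpha>z)\<close> is
  \<open>exp (-\<alpha>\<^sup>2/4\<eta>\<^sup>2 - \<eta>\<^sup>2z\<^sup>2)\<close> for either sign.
\<close>

section \<open>Exponential integrals\<close>

lemma expint_integrand_norm_le:
  assumes "t \<ge> 1"
  shows "norm (exp (- z * of_real t) / of_real t ^ n) \<le> exp (- Re z * t)"
proof -
  have "norm (exp (- z * of_real t) / of_real t ^ n) = exp (- Re z * t) / t ^ n"
    using assms by (simp add: norm_divide norm_power)
  also have "\<dots> \<le> exp (- Re z * t) / 1"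
    using assms by (intro divide_left_mono) auto
  finally show ?thesis by simp
qed

lemma expint_integrand_integrable_interval:
  fixes z :: complex
  shows "(\<lambda>t. exp (- z * of_real t) / of_real t ^ n) integrable_on {1..c::real}"
  by (intro integrable_continuous_interval continuous_intros) auto

text \<open>Dominated convergence with majorant \<open>exp (- Re z * t)\<close>. Identities can thus
  be proved on the compact intervals \<open>{1..real N}\<close>, where the fundamental theorem of
  calculus applies, and then passed to the limit.\<close>

lemma expint_integral_truncated:
  assumes "Re z > 0"
  shows "(\<lambda>N. integral {1..real N} (\<lambda>t. exp (- z * of_real t) / of_real t ^ n))
           \<longlonglongrightarrow> expint_integral n z"
proof -
  define f where "f = (\<lambda>t. exp (- z * of_real t) / of_real t ^ n)"
  have restr: "{1..real N} \<inter> {1..} = {1..real N}" for N by auto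
  have "(\<lambda>N. integral {1..} (\<lambda>t. if t \<in> {1..real N} then f t else 0)) \<longlonglongrightarrow> integral {1..} f"
  proof (rule dominated_convergence(2))
    show "(\<lambda>t. if t \<in> {1..real N} then f t else 0) integrable_on {1..}" for N
      using expint_integrand_integrable_interval[of z n "real N"]
      unfolding integrable_restrict_Int f_def restr .
    show "(\<lambda>t. exp (- Re z * t)) integrable_on {1..}"
      using integrable_on_exp_minus_to_infinity[OF assms] .
    show "norm (if t \<in> {1..real N} then f t else 0) \<le> exp (- Re z * t)" if "t \<in> {1..}" for N t
      using expint_integrand_norm_le[of t z n] that by (auto simp: f_def)
    show "(\<lambda>N. if t \<in> {1..real N} then f t else 0) \<longlonglongrightarrow> f t" if "t \<in> {1..}" for t
    proof (rule tendsto_eventually)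
      show "\<forall>\<^sub>F N in sequentially. (if t \<in> {1..real N} then f t else 0) = f t"
        using eventually_ge_at_top[of "nat \<lceil>t\<rceil>"]
        by eventually_elim (use that in \<open>auto simp: nat_le_iff ceiling_le_iff\<close>)
    qed
  qed
  then show ?thesis
    by (simp only: integral_restrict_Int restr expint_integral_def f_def)
qed

lemma exp_minus_mult_nat_tendsto_0:
  assumes "Re z > 0"
  shows "(\<lambda>N. exp (- z * of_nat N)) \<longlonglongrightarrow> 0"
proof -
  have "norm (exp (- z)) < 1" using assms by simp
  then have "(\<lambda>N. exp (- z) ^ N) \<longlonglongrightarrow> 0" by (rule LIMSEQ_power_zero)
  then show ?thesis by (simp only: exp_of_nat2_mult)
qed

text \<open>Integration by parts: the derivative of \<open>exp (- z * t) / t ^ n\<close> combines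
  the integrands of orders \<open>n\<close> and \<open>Suc n\<close>. Integrate it over
  \<open>{1..real N}\<close>; the boundary term at \<open>N\<close> tends to 0.\<close>

lemma expint_integral_recurrence:
  assumes "Re z > 0"
  shows "of_nat n * expint_integral (Suc n) z = exp (- z) - z * expint_integral n z"
proof -
  define f where "f = (\<lambda>n t. exp (- z * of_real t) / (of_real t :: complex) ^ n)"
  have int: "f m integrable_on {1..c}" for m c
    unfolding f_def by (rule expint_integrand_integrable_interval)
  have FTC: "((\<lambda>t. - z * f n t - of_nat n * f (Suc n) t) has_integral (f n (real N) - f n 1)) {1..real N}"
    if "N \<ge> 1" for N
  proof (rule fundamental_theorem_of_calculus)
    fix t assume t: "t \<in> {1..real N}"
    \<comment> \<open>For \<open>n = 0\<close> the truncated exponent \<open>n - 1\<close> is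
      harmless, because the factor \<open>of_nat n\<close> vanishes.\<close>
    have pow: "of_nat n * of_real t ^ n = of_nat n * (of_real t ^ (n - 1) * of_real t :: complex)"
      by (cases n) auto
    have "((\<lambda>w. exp (- z * w) / w ^ n) has_field_derivative (- z * f n t - of_nat n * f (Suc n) t))
            (at (of_real t))"
      using t pow unfolding f_def
      by (auto intro!: derivative_eq_intros simp: divide_simps) (simp add: algebra_simps)
    then have "((\<lambda>t. f n t) has_vector_derivative (- z * f n t - of_nat n * f (Suc n) t)) (at t)"
      unfolding f_def by (rule has_vector_derivative_real_field)
    then show "((\<lambda>t. f n t) has_vector_derivative (- z * f n t - of_nat n * f (Suc n) t))
                 (at t within {1..real N})"
      by (rule has_vector_derivative_at_within)
  qed (use that in simp)
  have eq: "- z * integral {1..real N} (f n) - of_nat n * integral {1..real N} (f (Suc n))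
              = f n (real N) - exp (- z)" if "N \<ge> 1" for N
  proof -
    have "integral {1..real N} (\<lambda>t. - z * f n t - of_nat n * f (Suc n) t)
            = - z * integral {1..real N} (f n) - of_nat n * integral {1..real N} (f (Suc n))"
      by (subst Henstock_Kurzweil_Integration.integral_diff[OF integrable_on_mult_right integrable_on_mult_right])
         (simp_all add: int)
    with integral_unique[OF FTC[OF that]] show ?thesis by (simp add: f_def)
  qed
  have "(\<lambda>N. - z * integral {1..real N} (f n) - of_nat n * integral {1..real N} (f (Suc n)))
          \<longlonglongrightarrow> - z * expint_integral n z - of_nat n * expint_integral (Suc n) z"
    unfolding f_def by (intro tendsto_intros expint_integral_truncated assms)
  moreover have "(\<lambda>N. f n (real N) - exp (- z)) \<longlonglongrightarrow> 0 - exp (- z)"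
  proof (intro tendsto_intros)
    show "(\<lambda>N. f n (real N)) \<longlonglongrightarrow> 0"
    proof (rule Lim_null_comparison)
      show "\<forall>\<^sub>F N in sequentially. norm (f n (real N)) \<le> norm (exp (- z * of_nat N))"
        using eventually_ge_at_top[of 1]
      proof eventually_elim
        case (elim N)
        then show ?case using expint_integrand_norm_le[of "real N" z n] by (simp add: f_def)
      qed
    qed (use tendsto_norm[OF exp_minus_mult_nat_tendsto_0[OF assms]] in simp)
  qed
  then have "(\<lambda>N. - z * integral {1..real N} (f n) - of_nat n * integral {1..real N} (f (Suc n)))
          \<longlonglongrightarrow> 0 - exp (- z)"
    by (rule Lim_transform_eventually)
       (use eq in \<open>auto intro!: eventually_sequentiallyI[of 1]\<close>)
  ultimately have "- z * expint_integral n z - of_nat n * expint_integral (Suc n) z = 0 - exp (- z)"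
    by (rule LIMSEQ_unique)
  then show ?thesis by (simp add: algebra_simps)
qed

text \<open>Differentiation under the integral cancels the factor 1/t, so the truncated integrals
  have elementary derivatives. These converge uniformly on a half-plane at positive distance from
  the imaginary axis, so limit and derivative may be exchanged.\<close>

lemma has_field_derivative_expint_integral_1:
  assumes "Re z > 0"
  shows "(expint_integral 1 has_field_derivative - exp (- z) / z) (at z)"
proof -
  \<comment> \<open>Half of \<open>Re z\<close> keeps \<open>z\<close> inside the half-plane
    \<open>S\<close> and gives the uniform lower bound |w| > a there.\<close>
  define a where "a = Re z / 2"
  define S where "S = {w. Re w > a}"
  have a: "a > 0" using assms by (simp add: a_def)
  have S: "convex S" "open S" "z \<in> S"
    unfolding S_def using assms
    by (simp_all only: convex_halfspace_Re_gt open_halfspace_Re_gt) (simp add: a_def)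
  define I where "I = (\<lambda>N (w::complex). integral {1..real N} (\<lambda>t. exp (- w * of_real t) / of_real t ^ 1))"
  have int_exp: "integral {1..real N} (\<lambda>t. - exp (- w * of_real t)) = (exp (- w * of_nat N) - exp (- w)) / w"
    if "w \<in> S" "N \<ge> 1" for w N
  proof -
    have w: "w \<noteq> 0" using that a by (auto simp: S_def)
    have "((\<lambda>t. - exp (- w * of_real t)) has_integral
             exp (- w * of_real (real N)) / w - exp (- w * of_real 1) / w) {1..real N}"
    proof (rule fundamental_theorem_of_calculus)
      fix t assume "t \<in> {1..real N}"
      have "((\<lambda>u. exp (- w * u) / w) has_field_derivative - exp (- w * of_real t)) (at (of_real t))"
        using w by (auto intro!: derivative_eq_intros)
      then show "((\<lambda>t. exp (- w * of_real t) / w) has_vector_derivative - exp (- w * of_real t))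
                   (at t within {1..real N})"
        by (rule has_vector_derivative_at_within[OF has_vector_derivative_real_field])
    qed (use that in simp)
    from integral_unique[OF this] show ?thesis by (simp add: diff_divide_distrib)
  qed
  \<comment> \<open>The sequence is shifted to \<open>Suc N\<close> because \<open>int_exp\<close>
    fails for the empty interval at \<open>N = 0\<close>.\<close>
  have "\<exists>g. \<forall>w\<in>S. (\<lambda>N. I (Suc N) w) \<longlonglongrightarrow> g w \<and>
           (g has_field_derivative (- exp (- w) / w)) (at w within S)"
  proof (rule has_complex_derivative_sequence[OF S(1)])
    fix N w assume w: "w \<in> S"
    have "((\<lambda>w. integral (cbox 1 (real (Suc N))) (\<lambda>t. exp (- w * of_real t) / of_real t ^ 1))
            has_field_derivative integral (cbox 1 (real (Suc N))) (\<lambda>t. - exp (- w * of_real t)))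
            (at w within S)"
    proof (rule leibniz_rule_field_derivative)
      show "((\<lambda>x. exp (- x * of_real t) / of_real t ^ 1) has_field_derivative - exp (- x * of_real t))
              (at x within S)" if "t \<in> cbox 1 (real (Suc N))" for x :: complex and t :: real
        using that by (auto intro!: derivative_eq_intros)
      show "(\<lambda>t. exp (- x * of_real t) / of_real t ^ 1) integrable_on cbox 1 (real (Suc N))" for x :: complex
        using expint_integrand_integrable_interval[of x 1 "real (Suc N)"] by simp
      show "continuous_on (S \<times> cbox 1 (real (Suc N))) (\<lambda>(x, t). - exp (- x * of_real t))"
        by (auto simp: case_prod_unfold intro!: continuous_intros)
    qed (use w S in auto)
    then show "(I (Suc N) has_field_derivative (exp (- w * of_nat (Suc N)) - exp (- w)) / w) (at w within S)"
      using int_exp[OF w, of "Suc N"] by (simp add: I_def)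
  next
    fix e :: real assume e: "e > 0"
    have "(\<lambda>N. exp (- of_real a * of_nat N) :: complex) \<longlonglongrightarrow> 0"
      by (rule exp_minus_mult_nat_tendsto_0) (use a in simp)
    then have "\<forall>\<^sub>F N in sequentially. dist (exp (- of_real a * of_nat N) :: complex) 0 < e * a"
      using e a by (intro tendstoD) auto
    \<comment> \<open>The tolerance \<open>e * a\<close> in place of \<open>e\<close> pays for the
      factor 1/|w| \<le> 1/a in the error term.\<close>
    then obtain M where M: "\<And>N. N \<ge> M \<Longrightarrow> exp (- a * real N) < e * a"
      by (auto simp: eventually_sequentially)
    have "norm ((exp (- w * of_nat (Suc N)) - exp (- w)) / w - - exp (- w) / w) \<le> e"
      if N: "N \<ge> M" and w: "w \<in> S" for N w
    proof -
      have nw: "norm w \<ge> a" using w complex_Re_le_cmod[of w] by (auto simp: S_def)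
      have "(exp (- w * of_nat (Suc N)) - exp (- w)) / w - - exp (- w) / w = exp (- w * of_nat (Suc N)) / w"
        by (simp add: diff_divide_distrib)
      also have "norm \<dots> = exp (- Re w * real (Suc N)) / norm w"
        by (simp add: norm_divide)
      also have "\<dots> \<le> exp (- a * real (Suc N)) / a"
        using w a nw by (intro frac_le) (auto simp: S_def intro: mult_right_mono)
      also have "\<dots> \<le> e"
        using M[of "Suc N"] N a by (simp add: divide_simps)
      finally show ?thesis .
    qed
    then show "\<exists>M. \<forall>N w. N \<ge> M \<longrightarrow> w \<in> S \<longrightarrow>
        norm ((exp (- w * of_nat (Suc N)) - exp (- w)) / w - - exp (- w) / w) \<le> e" by blast
  next
    show "\<exists>w l. w \<in> S \<and> (\<lambda>N. I (Suc N) w) \<longlonglongrightarrow> l"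
      using S(3) LIMSEQ_Suc[OF expint_integral_truncated[OF assms, of 1]]
      unfolding I_def by blast
  qed
  then obtain g where g: "\<And>w. w \<in> S \<Longrightarrow> (\<lambda>N. I (Suc N) w) \<longlonglongrightarrow> g w"
    "\<And>w. w \<in> S \<Longrightarrow> (g has_field_derivative (- exp (- w) / w)) (at w within S)" by blast
  have eq: "g w = expint_integral 1 w" if "w \<in> S" for w
  proof -
    have "Re w > 0" using that a by (simp add: S_def)
    from LIMSEQ_unique[OF g(1)[OF that, unfolded I_def] LIMSEQ_Suc[OF expint_integral_truncated[OF this]]]
    show ?thesis .
  qed
  have "(g has_field_derivative (- exp (- z) / z)) (at z)"
    using g(2)[OF S(3)] at_within_open[OF S(3,2)] by simp
  then show ?thesis
    by (rule has_field_derivative_transform_within_open[OF _ S(2,3) eq])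
qed

section \<open>Analytic continuation in the logarithmic coordinate\<close>

definition expint_strip :: "complex set" where
  "expint_strip = {w. \<bar>Im w\<bar> < pi / 2}"

lemma expint_strip_eq: "expint_strip = {w. Im w < pi / 2} \<inter> {w. Im w > - (pi / 2)}"
  by (auto simp: expint_strip_def)

lemma convex_expint_strip: "convex expint_strip"
  unfolding expint_strip_eq by (intro convex_Int convex_halfspace_Im_lt convex_halfspace_Im_gt)

lemma open_expint_strip: "open expint_strip"
  unfolding expint_strip_eq by (intro open_Int open_halfspace_Im_lt open_halfspace_Im_gt)

lemma zero_in_expint_strip: "0 \<in> expint_strip"
  by (simp add: expint_strip_def)

lemma Re_exp_pos_of_strip: "w \<in> expint_strip \<Longrightarrow> Re (exp w) > 0"
  by (auto simp: expint_strip_def Re_exp cos_gt_zero_pi abs_less_iff)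

text \<open>This is the property under the definite description in \<open>expint_lift\<close>,
  isolated so that existence and uniqueness can be treated separately.\<close>

definition is_expint_lift :: "nat \<Rightarrow> (complex \<Rightarrow> complex) \<Rightarrow> bool" where
  "is_expint_lift n F \<longleftrightarrow> F holomorphic_on UNIV \<and>
     (\<forall>w. \<bar>Im w\<bar> < pi / 2 \<longrightarrow> F w = expint_integral n (exp w))"

text \<open>The identity theorem for a nonempty open subset of the connected plane. It yields both
  the uniqueness of the lift and the transfer of the recurrence to every branch.\<close>

lemma holomorphic_eq_of_strip:
  assumes "f holomorphic_on UNIV" "g holomorphic_on UNIV" "\<And>w. w \<in> expint_strip \<Longrightarrow> f w = g w"
  shows "f w = g w"
  by (rule analytic_continuation_open[of expint_strip UNIV f g])
     (use assms open_expint_strip zero_in_expint_strip in auto)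

text \<open>
  In the coordinate \<open>w = log z\<close> the derivative \<open>- exp (- z) / z\<close> of \<open>E\<^sub>1\<close> becomes the entire function
  \<open>- exp (- exp w)\<close>.
\<close>

lemma ex_is_expint_lift_1: "\<exists>F. is_expint_lift 1 F"
proof -
  have "(\<lambda>w::complex. - exp (- exp w)) holomorphic_on UNIV"
    by (intro holomorphic_intros)
  then obtain g where "\<And>w::complex. w \<in> UNIV \<Longrightarrow> (g has_field_derivative - exp (- exp w)) (at w)"
    by (rule holomorphic_convex_primitive'[OF convex_UNIV open_UNIV]) blast
  then have g: "(g has_field_derivative - exp (- exp w)) (at w)" for w by blast
  \<comment> \<open>Both functions have derivative \<open>- exp (- exp w)\<close> on the convex
    strip, so they differ by a constant; subtracting it from the entire primitive gives the
    lift.\<close>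
  have "\<exists>c. \<forall>w\<in>expint_strip. g w - expint_integral 1 (exp w) = c"
  proof (rule has_field_derivative_zero_constant[OF convex_expint_strip])
    fix w assume w: "w \<in> expint_strip"
    have "((\<lambda>w. expint_integral 1 (exp w)) has_field_derivative - exp (- exp w) / exp w * exp w) (at w)"
      by (rule DERIV_chain2[OF has_field_derivative_expint_integral_1[OF Re_exp_pos_of_strip[OF w]] DERIV_exp])
    from DERIV_diff[OF g[of w] this]
    show "((\<lambda>w. g w - expint_integral 1 (exp w)) has_field_derivative 0) (at w within expint_strip)"
      by (simp add: has_field_derivative_at_within)
  qed
  then obtain c where c: "\<And>w. w \<in> expint_strip \<Longrightarrow> g w - expint_integral 1 (exp w) = c" by blast
  have "is_expint_lift 1 (\<lambda>w. g w - c)"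
    unfolding is_expint_lift_def
  proof (intro conjI allI impI)
    have "g holomorphic_on UNIV"
      using g by (auto simp: holomorphic_on_open)
    then show "(\<lambda>w. g w - c) holomorphic_on UNIV" by (intro holomorphic_intros)
    show "g w - c = expint_integral 1 (exp w)" if "\<bar>Im w\<bar> < pi / 2" for w
      using c[of w] that by (auto simp: expint_strip_def algebra_simps)
  qed
  then show ?thesis by blast
qed

text \<open>The recurrence solved for the higher order builds an entire lift from the preceding one.
  The induction starts at order 1, since passing from order 0 to order 1 would divide by 0.\<close>

lemma ex_is_expint_lift: "\<exists>F. is_expint_lift (Suc n) F"
proof (induction n)
  case 0
  then show ?case using ex_is_expint_lift_1 by simp
next
  case (Suc n)
  then obtain F where F: "is_expint_lift (Suc n) F" by blast
  have "is_expint_lift (Suc (Suc n)) (\<lambda>w. (exp (- exp w) - exp w * F w) / of_nat (Suc n))"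
    unfolding is_expint_lift_def
  proof (intro conjI allI impI)
    show "(\<lambda>w. (exp (- exp w) - exp w * F w) / of_nat (Suc n)) holomorphic_on UNIV"
      using F unfolding is_expint_lift_def by (intro holomorphic_intros) (auto simp del: of_nat_Suc)
    fix w :: complex assume w: "\<bar>Im w\<bar> < pi / 2"
    then have "Re (exp w) > 0" using Re_exp_pos_of_strip by (simp add: expint_strip_def)
    from expint_integral_recurrence[OF this, of "Suc n"]
    have "of_nat (Suc n) * expint_integral (Suc (Suc n)) (exp w) = exp (- exp w) - exp w * F w"
      using F w by (simp add: is_expint_lift_def del: of_nat_Suc)
    moreover have "of_nat (Suc n) \<noteq> (0::complex)" by (simp del: of_nat_Suc)
    ultimately show "(exp (- exp w) - exp w * F w) / of_nat (Suc n) = expint_integral (Suc (Suc n)) (exp w)"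
      by (metis nonzero_mult_div_cancel_left)
  qed
  then show ?case by blast
qed

lemma is_expint_lift_expint_lift: "is_expint_lift (Suc n) (expint_lift (Suc n))"
proof -
  have "\<exists>!F. is_expint_lift (Suc n) F"
  proof (rule ex_ex1I[OF ex_is_expint_lift])
    fix F G assume "is_expint_lift (Suc n) F" "is_expint_lift (Suc n) G"
    then show "F = G"
      using holomorphic_eq_of_strip[of F G]
      by (intro ext) (auto simp: is_expint_lift_def expint_strip_def)
  qed
  from theI'[OF this] show ?thesis
    unfolding expint_lift_def is_expint_lift_def .
qed

text \<open>Both sides are entire, and on the strip the identity is the one obtained by
  parts.\<close>

lemma expint_lift_recurrence:
  "of_nat (Suc n) * expint_lift (Suc (Suc n)) w = exp (- exp w) - exp w * expint_lift (Suc n) w"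
proof (rule holomorphic_eq_of_strip[where f = "\<lambda>w. of_nat (Suc n) * expint_lift (Suc (Suc n)) w"])
  note lift = is_expint_lift_expint_lift[unfolded is_expint_lift_def]
  show "(\<lambda>w. of_nat (Suc n) * expint_lift (Suc (Suc n)) w) holomorphic_on UNIV"
    "(\<lambda>w. exp (- exp w) - exp w * expint_lift (Suc n) w) holomorphic_on UNIV"
    using lift by (auto intro!: holomorphic_intros)
  fix w assume w: "w \<in> expint_strip"
  show "of_nat (Suc n) * expint_lift (Suc (Suc n)) w = exp (- exp w) - exp w * expint_lift (Suc n) w"
    using expint_integral_recurrence[OF Re_exp_pos_of_strip[OF w], of "Suc n"] lift w
    by (simp add: expint_strip_def del: of_nat_Suc)
qed

section \<open>Branch values and their growth in the order\<close>

lemma expint_recurrence: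
  assumes "z \<noteq> 0"
  shows "of_nat (Suc n) * expint b (Suc (Suc n)) z = exp (- z) - z * expint b (Suc n) z"
proof (cases "Re z > 0")
  case True
  then show ?thesis
    using expint_integral_recurrence[OF True, of "Suc n"] by (simp add: expint_def)
next
  case False
  \<comment> \<open>The branch shift is invisible to \<open>exp\<close>, and all orders are
    evaluated at the same logarithm of \<open>z\<close>; the recurrence of the lifts therefore
    becomes one in \<open>z\<close> itself.\<close>
  have "exp (Ln z + 2 * of_int b * of_real pi * \<i>) = z"
    using assms by (simp add: exp_add exp_eq_1)
  with False show ?thesis
    using expint_lift_recurrence[of n "Ln z + 2 * of_int b * of_real pi * \<i>"]
    by (simp add: expint_def)
qed

text \<open>The integral gives no estimate on the continued branches, so the recurrence is iterated
  instead. \<open>C\<close> covers the first value and the inhomogeneity \<open>exp (- z)\<close>;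
  each step costs at most the factor 1 + |z|, after the gain from dividing by \<open>Suc q\<close>
  is given away.\<close>

lemma expint_geometric_bound:
  assumes "z \<noteq> 0"
  obtains C D where "\<And>q. norm (expint b (Suc q) z) \<le> C * D ^ q"
proof
  define C where "C = max (norm (exp (- z))) (norm (expint b 1 z))"
  define D where "D = 1 + norm z"
  have C0: "C \<ge> 0" by (auto simp: C_def le_max_iff_disj)
  show "norm (expint b (Suc q) z) \<le> C * D ^ q" for q
  proof (induction q)
    case 0
    then show ?case by (simp add: C_def)
  next
    case (Suc q)
    have D1: "D ^ q \<ge> 1" by (rule one_le_power) (simp add: D_def)
    have "norm (expint b (Suc (Suc q)) z) \<le> real (Suc q) * norm (expint b (Suc (Suc q)) z)"
      using mult_right_mono[of 1 "real (Suc q)" "norm (expint b (Suc (Suc q)) z)"] by simp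
    also have "\<dots> = norm (exp (- z) - z * expint b (Suc q) z)"
      unfolding expint_recurrence[OF assms, symmetric] by (simp add: norm_mult del: of_nat_Suc)
    also have "\<dots> \<le> norm (exp (- z)) + norm z * norm (expint b (Suc q) z)"
      by (metis norm_mult norm_triangle_ineq4)
    also have "\<dots> \<le> C * D ^ q + norm z * (C * D ^ q)"
    proof (intro add_mono mult_left_mono Suc)
      have "norm (exp (- z)) \<le> C * 1" by (simp add: C_def)
      also have "\<dots> \<le> C * D ^ q" using D1 C0 by (intro mult_left_mono)
      finally show "norm (exp (- z)) \<le> C * D ^ q" .
    qed auto
    also have "\<dots> = C * D ^ Suc q" by (simp add: D_def algebra_simps)
    finally show ?case .
  qed
qed

section \<open>Iterated partial derivatives\<close>

lemma relpowp_iterate: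
  assumes "\<And>n. P (F n) (F (Suc n))"
  shows "(P ^^ n) (F 0) (F n)"
  using assms by (induction n) (auto intro: relpowp_Suc_I)

text \<open>A family indexed by derivative orders and closed under differentiation gives all
  iterated partials at once. \<open>W\<close> need not split into a product, because the
  one-dimensional series couples \<open>y\<close> and \<open>z\<close>. The variables are complex so
  that holomorphic calculus applies.\<close>

lemma has_partial_derivs_separable:
  fixes X :: "nat \<Rightarrow> complex \<Rightarrow> complex" and W :: "nat \<Rightarrow> nat \<Rightarrow> complex \<Rightarrow> complex \<Rightarrow> complex"
  assumes X: "\<And>a x. (X a has_field_derivative X (Suc a) x) (at x)"
    and Y: "\<And>b c y z. ((\<lambda>y. W b c y z) has_field_derivative W (Suc b) c y z) (at y)"
    and Z: "\<And>b c y z. (W b c y has_field_derivative W b (Suc c) y z) (at z)"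
  shows "has_partial_derivs p\<^sub>x p\<^sub>y p\<^sub>z
           (\<lambda>R. X 0 (of_real (R $ 1)) * W 0 0 (of_real (R $ 2)) (of_real (R $ 3)))
           (\<lambda>R. X p\<^sub>x (of_real (R $ 1)) * W p\<^sub>y p\<^sub>z (of_real (R $ 2)) (of_real (R $ 3)))"
proof -
  define F where
    "F = (\<lambda>a b c (R::real^3). X a (of_real (R $ 1)) * W b c (of_real (R $ 2)) (of_real (R $ 3)))"
  \<comment> \<open>A complex derivative restricts to the real line through \<open>u\<close> as a
    vector derivative.\<close>
  have line: "((\<lambda>t. f (of_real (u + t))) has_vector_derivative f' (of_real u)) (at 0)"
    if "\<And>x. (f has_field_derivative f' x) (at x)" for f f' :: "complex \<Rightarrow> complex" and u :: real
  proof -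
    have "((\<lambda>w. f (of_real u + w)) has_field_derivative f' (of_real u)) (at (of_real 0))"
      using that[of "of_real u"] DERIV_shift[of f "f' (of_real u)" "0" "of_real u"]
      by (simp add: add.commute)
    from has_vector_derivative_real_field[OF this] show ?thesis by simp
  qed
  have "has_partial 1 (F a b c) (F (Suc a) b c)" for a b c
    unfolding has_partial_def
  proof
    fix R :: "real^3"
    show "((\<lambda>t. F a b c (R + t *\<^sub>R axis 1 1)) has_vector_derivative F (Suc a) b c R) (at 0)"
      using has_vector_derivative_mult_left[OF line[OF X[of a], of "R $ 1"],
          of "W b c (of_real (R $ 2)) (of_real (R $ 3))"]
      by (simp add: F_def axis_def)
  qed
  moreover have "has_partial 2 (F a b c) (F a (Suc b) c)" for a b c
    unfolding has_partial_def
  proof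
    fix R :: "real^3"
    show "((\<lambda>t. F a b c (R + t *\<^sub>R axis 2 1)) has_vector_derivative F a (Suc b) c R) (at 0)"
      using has_vector_derivative_mult_right[OF line[OF Y[of b c "of_real (R $ 3)"], of "R $ 2"],
          of "X a (of_real (R $ 1))"]
      by (simp add: F_def axis_def)
  qed
  moreover have "has_partial 3 (F a b c) (F a b (Suc c))" for a b c
    unfolding has_partial_def
  proof
    fix R :: "real^3"
    show "((\<lambda>t. F a b c (R + t *\<^sub>R axis 3 1)) has_vector_derivative F a b (Suc c) R) (at 0)"
      using has_vector_derivative_mult_right[OF line[OF Z[of b c "of_real (R $ 2)"], of "R $ 3"],
          of "X a (of_real (R $ 1))"]
      by (simp add: F_def axis_def)
  qed
  \<comment> \<open>The indices are raised one at a time in the order z, y, x fixed by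
    \<open>has_partial_derivs\<close>.\<close>
  ultimately have "(has_partial 3 ^^ p\<^sub>z) (F 0 0 0) (F 0 0 p\<^sub>z)"
    "(has_partial 2 ^^ p\<^sub>y) (F 0 0 p\<^sub>z) (F 0 p\<^sub>y p\<^sub>z)"
    "(has_partial 1 ^^ p\<^sub>x) (F 0 p\<^sub>y p\<^sub>z) (F p\<^sub>x p\<^sub>y p\<^sub>z)"
    using relpowp_iterate[of "has_partial 3" "F 0 0" p\<^sub>z]
      relpowp_iterate[of "has_partial 2" "\<lambda>b. F 0 b p\<^sub>z" p\<^sub>y]
      relpowp_iterate[of "has_partial 1" "\<lambda>a. F a p\<^sub>y p\<^sub>z" p\<^sub>x] by auto
  then have "has_partial_derivs p\<^sub>x p\<^sub>y p\<^sub>z (F 0 0 0) (F p\<^sub>x p\<^sub>y p\<^sub>z)"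
    unfolding has_partial_derivs_def by blast
  then show ?thesis by (simp add: F_def)
qed

lemma has_field_derivative_exp_iterate:
  fixes a c x :: complex
  shows "((\<lambda>x. a ^ n * (exp (a * x) / c)) has_field_derivative a ^ Suc n * (exp (a * x) / c)) (at x)"
  by (cases "c = 0") (auto intro!: derivative_eq_intros)

section \<open>Series in the squared radius\<close>

text \<open>For \<open>a > n\<close> the exponent is truncated, but the binomial coefficient vanishes.\<close>

definition monom_deriv :: "nat \<Rightarrow> nat \<Rightarrow> complex \<Rightarrow> complex" where
  "monom_deriv a n y = fact a * of_nat (n choose a) * y ^ (n - a)"

text \<open>The absorption identity (a+1) C(n,a+1) = C(n,a) (n-a) carries the step. It also covers a
  \<ge> n, where both sides are 0.\<close>

lemma has_field_derivative_monom_deriv: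
  "(monom_deriv a n has_field_derivative monom_deriv (Suc a) n y) (at y)"
proof -
  have "of_nat (Suc a) * of_nat (n choose Suc a) = of_nat (n choose a) * (of_nat (n - a) :: complex)"
    using binomial_absorption[of a n] binomial_absorb_comp[of n a]
    by (simp only: of_nat_mult[symmetric] mult.commute)
  then have eq: "monom_deriv (Suc a) n y = fact a * of_nat (n choose a) * (of_nat (n - a) * y ^ (n - Suc a))"
    by (simp add: monom_deriv_def algebra_simps del: of_nat_Suc)
  show ?thesis
    unfolding monom_deriv_def[abs_def] eq[unfolded monom_deriv_def]
    by (rule derivative_eq_intros refl | simp)+
qed

text \<open>Bounding the binomial coefficient by 2^n leaves a factor \<open>fact a\<close>
  independent of \<open>n\<close>; r \<ge> 1 allows the exponent \<open>n - a\<close> to be raised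
  to \<open>n\<close>.\<close>

lemma norm_monom_deriv_le:
  assumes "norm y \<le> r" "r \<ge> 1"
  shows "norm (monom_deriv a n y) \<le> fact a * (2 * r) ^ n"
proof -
  have "real (n choose a) \<le> 2 ^ n"
    using of_nat_mono[OF binomial_le_pow2[of n a], where 'a = real] by simp
  moreover have "norm y ^ (n - a) \<le> r ^ n"
    by (rule order_trans[OF power_mono[OF assms(1)] power_increasing]) (use assms in auto)
  ultimately have "fact a * (real (n choose a) * norm y ^ (n - a)) \<le> fact a * (2 ^ n * r ^ n)"
    using assms by (intro mult_left_mono mult_mono) auto
  then show ?thesis
    by (simp add: monom_deriv_def norm_mult norm_power power_mult_distrib mult.assoc)
qed

text \<open>The mixed partial derivative, \<open>b\<close> times in \<open>y\<close> and
  \<open>c\<close> times in \<open>z\<close>, of (y^2 + z^2)^q after binomial expansion.\<close>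

definition radial_term_deriv :: "nat \<Rightarrow> nat \<Rightarrow> complex \<Rightarrow> complex \<Rightarrow> nat \<Rightarrow> complex" where
  "radial_term_deriv b c y z q =
     (\<Sum>m\<le>q. of_nat (q choose m) * (monom_deriv b (2 * q - 2 * m) y * monom_deriv c (2 * m) z))"

lemma radial_term_deriv_0: "radial_term_deriv 0 0 y z q = (y\<^sup>2 + z\<^sup>2) ^ q"
proof -
  have "(y\<^sup>2 + z\<^sup>2) ^ q = (\<Sum>m\<le>q. of_nat (q choose m) * (z\<^sup>2) ^ m * (y\<^sup>2) ^ (q - m))"
    by (subst add.commute) (rule binomial_ring)
  also have "\<dots> = radial_term_deriv 0 0 y z q"
    unfolding radial_term_deriv_def
    by (intro sum.cong) (auto simp: monom_deriv_def power_mult[symmetric] right_diff_distrib')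
  finally show ?thesis by simp
qed

lemma has_field_derivative_radial_term_deriv:
  "((\<lambda>y. radial_term_deriv b c y z q) has_field_derivative radial_term_deriv (Suc b) c y z q) (at y)"
  "((\<lambda>z. radial_term_deriv b c y z q) has_field_derivative radial_term_deriv b (Suc c) y z q) (at z)"
  unfolding radial_term_deriv_def
  by (intro DERIV_sum DERIV_cmult DERIV_cmult_right has_field_derivative_monom_deriv)+

text \<open>The powers of \<open>2 * r\<close> combine to (2r)^(2q) for every \<open>m\<close>, and
  the binomial row sum adds 2^q. The bound is geometric in \<open>q\<close>, hence beaten by
  1/q!.\<close>

lemma norm_radial_term_deriv_le:
  assumes "norm y \<le> r" "norm z \<le> r" "r \<ge> 1"
  shows "norm (radial_term_deriv b c y z q) \<le> fact b * fact c * (8 * r\<^sup>2) ^ q"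
proof -
  have "norm (radial_term_deriv b c y z q)
          \<le> (\<Sum>m\<le>q. real (q choose m) * (fact b * (2 * r) ^ (2 * q - 2 * m) * (fact c * (2 * r) ^ (2 * m))))"
    unfolding radial_term_deriv_def
  proof (rule sum_norm_le)
    show "norm (of_nat (q choose m) * (monom_deriv b (2 * q - 2 * m) y * monom_deriv c (2 * m) z))
            \<le> real (q choose m) * (fact b * (2 * r) ^ (2 * q - 2 * m) * (fact c * (2 * r) ^ (2 * m)))" for m
      unfolding norm_mult norm_of_nat
      by (intro mult_left_mono mult_mono norm_monom_deriv_le assms) (use assms in auto)
  qed
  also have "\<dots> = (\<Sum>m\<le>q. real (q choose m) * (fact b * fact c * (2 * r) ^ (2 * q)))"
  proof (intro sum.cong refl)
    fix m assume "m \<in> {..q}"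
    then have "(2 * r) ^ (2 * q) = (2 * r) ^ (2 * q - 2 * m) * (2 * r) ^ (2 * m)"
      by (subst power_add[symmetric]) simp
    then show "real (q choose m) * (fact b * (2 * r) ^ (2 * q - 2 * m) * (fact c * (2 * r) ^ (2 * m)))
        = real (q choose m) * (fact b * fact c * (2 * r) ^ (2 * q))" by simp
  qed
  also have "\<dots> = real (\<Sum>m\<le>q. q choose m) * (fact b * fact c * (2 * r) ^ (2 * q))"
    by (simp only: sum_distrib_right of_nat_sum)
  also have "\<dots> = fact b * fact c * (2 ^ q * ((2 * r)\<^sup>2) ^ q)"
    by (simp add: choose_row_sum power_mult)
  also have "\<dots> = fact b * fact c * (8 * r\<^sup>2) ^ q"
    by (subst power_mult_distrib[symmetric]) simp
  finally show ?thesis .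
qed

section \<open>Termwise differentiation for factorially decaying coefficients\<close>

context
  fixes a :: "nat \<Rightarrow> complex" and K D :: real
  assumes a_bound: "\<And>q. norm (a q) \<le> K * D ^ q / fact q"
begin

lemma radial_series_majorant:
  assumes "norm y \<le> r" "norm z \<le> r" "r \<ge> 1"
  shows "norm (a q * radial_term_deriv b c y z q) \<le> K * (fact b * fact c) * ((D * (8 * r\<^sup>2)) ^ q / fact q)"
proof -
  \<comment> \<open>The signs of \<open>K\<close> and \<open>D\<close> are not prescribed; the bound
    is nonnegative because it dominates a norm.\<close>
  have "norm (a q) * norm (radial_term_deriv b c y z q) \<le> (K * D ^ q / fact q) * (fact b * fact c * (8 * r\<^sup>2) ^ q)"
    by (rule mult_mono[OF a_bound norm_radial_term_deriv_le[OF assms]])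
       (use order_trans[OF norm_ge_zero a_bound] in auto)
  then show ?thesis by (simp add: norm_mult power_mult_distrib algebra_simps)
qed

lemma summable_radial_series_majorant:
  "summable (\<lambda>q. K * (fact b * fact c) * ((D * (8 * r\<^sup>2)) ^ q / fact q))"
  using summable_exp[of "D * (8 * r\<^sup>2)"] by (intro summable_mult) (simp add: divide_inverse mult.commute)

lemma summable_radial_series: "summable (\<lambda>q. a q * radial_term_deriv b c y z q)"
  by (rule summable_comparison_test'[OF summable_radial_series_majorant])
     (rule radial_series_majorant[where r = "norm y + norm z + 1"], auto)

text \<open>By the Weierstrass test the differentiated series converges uniformly on a ball. The
  radius |y| + |z| + 1 puts \<open>y\<close> in the interior, dominates |z| and is at least 1, as
  the majorant requires.\<close>

lemma has_field_derivative_radial_series_1: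
  "((\<lambda>y. \<Sum>q. a q * radial_term_deriv b c y z q)
     has_field_derivative (\<Sum>q. a q * radial_term_deriv (Suc b) c y z q)) (at y)"
proof (rule has_field_derivative_series'(2))
  let ?r = "norm y + norm z + 1"
  show "uniformly_convergent_on (ball 0 ?r) (\<lambda>n y. \<Sum>q<n. a q * radial_term_deriv (Suc b) c y z q)"
    by (rule Weierstrass_m_test'[OF _ summable_radial_series_majorant])
       (rule radial_series_majorant[where r = ?r], auto)
  show "summable (\<lambda>q. a q * radial_term_deriv b c y z q)" by (rule summable_radial_series)
  show "((\<lambda>y. a q * radial_term_deriv b c y z q)
          has_field_derivative a q * radial_term_deriv (Suc b) c y z q) (at y within ball 0 ?r)" for q y
    by (rule has_field_derivative_at_within[OF DERIV_cmult[OF has_field_derivative_radial_term_deriv(1)]])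
  have "norm y < ?r" using norm_ge_zero[of z] by linarith
  then show "y \<in> ball 0 ?r" "y \<in> interior (ball 0 ?r)"
    by (simp_all add: interior_open)
qed simp

lemma has_field_derivative_radial_series_2:
  "((\<lambda>z. \<Sum>q. a q * radial_term_deriv b c y z q)
     has_field_derivative (\<Sum>q. a q * radial_term_deriv b (Suc c) y z q)) (at z)"
proof (rule has_field_derivative_series'(2))
  let ?r = "norm y + norm z + 1"
  show "uniformly_convergent_on (ball 0 ?r) (\<lambda>n z. \<Sum>q<n. a q * radial_term_deriv b (Suc c) y z q)"
    by (rule Weierstrass_m_test'[OF _ summable_radial_series_majorant])
       (rule radial_series_majorant[where r = ?r], auto)
  show "summable (\<lambda>q. a q * radial_term_deriv b c y z q)" by (rule summable_radial_series)
  show "((\<lambda>z. a q * radial_term_deriv b c y z q)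
          has_field_derivative a q * radial_term_deriv b (Suc c) y z q) (at z within ball 0 ?r)" for q z
    by (rule has_field_derivative_at_within[OF DERIV_cmult[OF has_field_derivative_radial_term_deriv(2)]])
  have "norm z < ?r" using norm_ge_zero[of y] by linarith
  then show "z \<in> ball 0 ?r" "z \<in> interior (ball 0 ?r)"
    by (simp_all add: interior_open)
qed simp

end

section \<open>The Ewald terms\<close>

lemma has_field_derivative_erfc:
  "(erfc has_field_derivative - (2 / of_real (sqrt pi)) * exp (- (z\<^sup>2))) (at z)"
proof -
  have "(\<lambda>t::complex. exp (- (t\<^sup>2))) holomorphic_on UNIV" by (intro holomorphic_intros)
  \<comment> \<open>An entire primitive of the Gaussian turns the contour integral into a difference
    of values.\<close>
  then obtain g where "\<And>t::complex. t \<in> UNIV \<Longrightarrow> (g has_field_derivative exp (- (t\<^sup>2))) (at t)"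
    by (rule holomorphic_convex_primitive'[OF convex_UNIV open_UNIV]) blast
  then have g: "(g has_field_derivative exp (- (t\<^sup>2))) (at t)" for t by blast
  have "contour_integral (linepath 0 w) (\<lambda>t. exp (- (t\<^sup>2))) = g w - g 0" for w
    using contour_integral_primitive[of UNIV g "\<lambda>t. exp (- (t\<^sup>2))" "linepath 0 w"] g
    by (simp add: contour_integral_unique)
  then have eq: "erfc = (\<lambda>w. 1 - 2 / of_real (sqrt pi) * (g w - g 0))"
    by (simp add: erfc_def fun_eq_iff)
  show ?thesis
    unfolding eq by (auto intro!: derivative_eq_intros g)
qed

lemma holomorphic_erfc: "erfc holomorphic_on UNIV"
  using has_field_derivative_erfc by (auto simp: holomorphic_on_open)

text \<open>The first derivative produces the Gaussian and only the remaining \<open>n\<close>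
  produce a Hermite polynomial; hence the index \<open>m - 1\<close> in the final formula.\<close>

lemma higher_deriv_erfc:
  "(deriv ^^ Suc n) erfc u = - (2 / of_real (sqrt pi)) * ((-1) ^ n * exp (- (u\<^sup>2)) * hermite n u)"
proof -
  have "deriv erfc = (\<lambda>v. - (2 / of_real (sqrt pi)) * exp (- (v\<^sup>2)))"
    using has_field_derivative_erfc by (intro ext DERIV_imp_deriv)
  then have "(deriv ^^ Suc n) erfc u = (deriv ^^ n) (\<lambda>v. - (2 / of_real (sqrt pi)) * exp (- (v\<^sup>2))) u"
    by (simp add: funpow_Suc_right del: funpow.simps)
  also have "\<dots> = - (2 / of_real (sqrt pi)) * (deriv ^^ n) (\<lambda>v. exp (- (v\<^sup>2))) u"
    by (rule higher_deriv_cmult[of _ UNIV]) (auto intro!: holomorphic_intros)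
  also have "(deriv ^^ n) (\<lambda>v. exp (- (v\<^sup>2))) u = (-1) ^ n * exp (- (u\<^sup>2)) * hermite n u"
    by (simp add: hermite_def exp_minus field_simps flip: power_mult_distrib)
  finally show ?thesis .
qed

lemma higher_deriv_exp_mult:
  fixes a z :: complex
  shows "(deriv ^^ n) (\<lambda>z. exp (a * z)) z = a ^ n * exp (a * z)"
proof -
  have "(deriv ^^ n) exp = (exp :: complex \<Rightarrow> complex)"
    by (induction n) (auto intro!: DERIV_imp_deriv)
  then show ?thesis
    by (subst higher_deriv_compose_linear[of exp UNIV UNIV]) (auto intro!: holomorphic_intros)
qed

section \<open>The two-dimensional term\<close>

text \<open>One summand of the sum over signs, without the modulus, so that it is entire in
  \<open>z\<close>.\<close>

definition exp_erfc :: "real \<Rightarrow> complex \<Rightarrow> complex \<Rightarrow> complex \<Rightarrow> complex" where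
  "exp_erfc \<eta> \<alpha> s z = exp (s * \<alpha> * z) * erfc (\<alpha> / of_real (2 * \<eta>) + s * (of_real \<eta> * z))"

lemma holomorphic_exp_erfc:
  assumes "\<eta> \<noteq> 0"
  shows "exp_erfc \<eta> \<alpha> s holomorphic_on UNIV"
  unfolding exp_erfc_def[abs_def] using assms
  by (intro holomorphic_intros holomorphic_on_compose_gen[OF _ holomorphic_erfc, unfolded o_def]) auto

text \<open>The cross term of the square is \<open>s * \<alpha> * z\<close>, which cancels the
  exponent of the first factor.\<close>

lemma gauss_exp_erfc:
  fixes s z \<alpha> :: complex and \<eta> :: real
  assumes eta: "\<eta> \<noteq> 0" and s: "s\<^sup>2 = 1"
  shows "exp (s * \<alpha> * z) * exp (- ((\<alpha> / of_real (2 * \<eta>) + s * (of_real \<eta> * z))\<^sup>2))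
           = exp (- (\<alpha>\<^sup>2 / of_real (4 * \<eta>\<^sup>2)) - (of_real \<eta>)\<^sup>2 * z\<^sup>2)"
proof -
  have "(\<alpha> / of_real (2 * \<eta>) + s * (of_real \<eta> * z))\<^sup>2
          = \<alpha>\<^sup>2 / of_real (4 * \<eta>\<^sup>2) + s * \<alpha> * z + s\<^sup>2 * ((of_real \<eta>)\<^sup>2 * z\<^sup>2)"
    using eta by (simp add: power2_eq_square field_simps)
  then show ?thesis using s by (simp flip: exp_add)
qed

lemma higher_deriv_exp_erfc:
  fixes s z \<alpha> :: complex and \<eta> :: real
  assumes eta: "\<eta> \<noteq> 0" and s: "s\<^sup>2 = 1"
  defines "u \<equiv> \<lambda>z. \<alpha> / of_real (2 * \<eta>) + s * (of_real \<eta> * z)"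
  shows "(deriv ^^ n) (exp_erfc \<eta> \<alpha> s) z = s ^ n *
           ((\<Sum>m = 1..n. of_nat (n choose m) *
              (of_real ((- \<eta>) ^ m) / \<alpha> powi (int m - int n)) * (2 / of_real (sqrt pi)) *
              hermite (m - 1) (u z) * exp (- (\<alpha>\<^sup>2 / of_real (4 * \<eta>\<^sup>2)) - (of_real \<eta>)\<^sup>2 * z\<^sup>2))
            + \<alpha> ^ n * exp (s * \<alpha> * z) * erfc (u z))"
proof -
  define c where "c = \<alpha> / of_real (2 * \<eta>)"
  define r where "r = s * of_real \<eta>"
  have u: "u z = r * z + c" for z by (simp add: u_def r_def c_def)
  have erfc_lin: "(deriv ^^ m) (\<lambda>w. erfc (r * w + c)) z = r ^ m * (deriv ^^ m) erfc (r * z + c)" for m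
    by (rule higher_deriv_compose_linear'[OF holomorphic_erfc open_UNIV open_UNIV]) auto
  have "exp_erfc \<eta> \<alpha> s = (\<lambda>w. erfc (r * w + c) * exp (s * \<alpha> * w))"
    by (simp add: exp_erfc_def fun_eq_iff r_def c_def algebra_simps)
  then have "(deriv ^^ n) (exp_erfc \<eta> \<alpha> s) z = (\<Sum>m = 0..n. of_nat (n choose m) *
      (deriv ^^ m) (\<lambda>w. erfc (r * w + c)) z * (deriv ^^ (n - m)) (\<lambda>w. exp (s * \<alpha> * w)) z)"
    by (simp only:)
       (rule higher_deriv_mult[of _ UNIV],
        auto intro!: holomorphic_intros holomorphic_on_compose_gen[OF _ holomorphic_erfc, unfolded o_def])
  also have "\<dots> = (\<Sum>m = 0..n. of_nat (n choose m) *
      (r ^ m * (deriv ^^ m) erfc (u z)) * ((s * \<alpha>) ^ (n - m) * exp (s * \<alpha> * z)))"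
    by (simp only: erfc_lin higher_deriv_exp_mult u)
  \<comment> \<open>The Leibniz term \<open>m = 0\<close> is split off: it alone keeps
    \<open>erfc\<close> undifferentiated.\<close>
  also have "\<dots> = erfc (u z) * ((s * \<alpha>) ^ n * exp (s * \<alpha> * z)) + (\<Sum>m = 1..n. of_nat (n choose m) *
      (r ^ m * (deriv ^^ m) erfc (u z)) * ((s * \<alpha>) ^ (n - m) * exp (s * \<alpha> * z)))"
    by (simp add: sum.atLeast_Suc_atMost)
  also have "(\<Sum>m = 1..n. of_nat (n choose m) *
      (r ^ m * (deriv ^^ m) erfc (u z)) * ((s * \<alpha>) ^ (n - m) * exp (s * \<alpha> * z))) =
      (\<Sum>m = 1..n. s ^ n * (of_nat (n choose m) *
              (of_real ((- \<eta>) ^ m) / \<alpha> powi (int m - int n)) * (2 / of_real (sqrt pi)) *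
              hermite (m - 1) (u z) * exp (- (\<alpha>\<^sup>2 / of_real (4 * \<eta>\<^sup>2)) - (of_real \<eta>)\<^sup>2 * z\<^sup>2)))"
  proof (intro sum.cong refl)
    fix m assume "m \<in> {1..n}"
    then obtain j where m: "m = Suc j" "Suc j \<le> n" by (cases m) auto
    \<comment> \<open>Since m \<le> n the integer exponent is nonpositive, and dividing by this
      power means multiplying by \<open>\<alpha> ^ (n - m)\<close>.\<close>
    have powi: "inverse (\<alpha> powi (int m - int n)) = \<alpha> ^ (n - m)"
    proof -
      have "int m - int n = - int (n - m)" using m by simp
      then show ?thesis by (simp only: power_int_minus power_int_of_nat inverse_inverse_eq)
    qed
    \<comment> \<open>The minus sign of the derivative of \<open>erfc\<close> joins the sign (-1)^j
      from the Hermite polynomial, with \<open>m = Suc j\<close>.\<close>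
    have sgn: "(- 1) * (- 1) ^ j * of_real \<eta> ^ m = (of_real ((- \<eta>) ^ m) :: complex)"
      by (simp add: m power_minus[of "of_real \<eta>"])
    have spow: "s ^ m * s ^ (n - m) = s ^ n" using m by (subst power_add[symmetric]) simp
    have "of_nat (n choose m) * (r ^ m * (deriv ^^ m) erfc (u z)) * ((s * \<alpha>) ^ (n - m) * exp (s * \<alpha> * z)) =
        (s ^ m * s ^ (n - m)) * (of_nat (n choose m) * (((- 1) * (- 1) ^ j * of_real \<eta> ^ m) * \<alpha> ^ (n - m)) *
          (2 / of_real (sqrt pi)) * hermite j (u z) * (exp (s * \<alpha> * z) * exp (- ((u z)\<^sup>2))))"
      unfolding m(1) higher_deriv_erfc r_def power_mult_distrib by (simp only: mult_ac) simp
    also have "\<dots> = s ^ n * (of_nat (n choose m) *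
              (of_real ((- \<eta>) ^ m) / \<alpha> powi (int m - int n)) * (2 / of_real (sqrt pi)) *
              hermite (m - 1) (u z) * exp (- (\<alpha>\<^sup>2 / of_real (4 * \<eta>\<^sup>2)) - (of_real \<eta>)\<^sup>2 * z\<^sup>2))"
      unfolding sgn spow u_def gauss_exp_erfc[OF eta s] divide_inverse[of "of_real ((- \<eta>) ^ m)"] powi
      by (simp add: m)
    finally show "of_nat (n choose m) * (r ^ m * (deriv ^^ m) erfc (u z)) * ((s * \<alpha>) ^ (n - m) * exp (s * \<alpha> * z)) =
        s ^ n * (of_nat (n choose m) *
              (of_real ((- \<eta>) ^ m) / \<alpha> powi (int m - int n)) * (2 / of_real (sqrt pi)) *
              hermite (m - 1) (u z) * exp (- (\<alpha>\<^sup>2 / of_real (4 * \<eta>\<^sup>2)) - (of_real \<eta>)\<^sup>2 * z\<^sup>2))" .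
  qed
  finally show ?thesis
    by (simp add: sum_distrib_left distrib_left power_mult_distrib mult_ac)
qed

text \<open>The sum over both signs is even in \<open>R\<^sub>z\<close>, so the modulus in the definition is immaterial.\<close>

lemma ewald2_eq:
  "ewald2 \<eta> A \<alpha> k R =
     exp (\<i> * of_real (k $ 1 * R $ 1 + k $ 2 * R $ 2)) / (4 * of_real A * \<alpha>) *
     (\<Sum>s\<in>{1, -1}. exp_erfc \<eta> \<alpha> s (of_real (R $ 3)))"
  unfolding ewald2_def exp_erfc_def
  by (cases "R $ 3 \<ge> 0") (simp_all add: one_neq_neg_one)

lemma has_partial_derivs_ewald2:
  assumes "\<eta> \<noteq> 0"
  shows "has_partial_derivs p\<^sub>x p\<^sub>y p\<^sub>z (ewald2 \<eta> A \<alpha> k)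
          (\<lambda>R. (\<i> * of_real (k $ 1)) ^ p\<^sub>x * (\<i> * of_real (k $ 2)) ^ p\<^sub>y *
             (exp (\<i> * of_real (k $ 1 * R $ 1 + k $ 2 * R $ 2)) / (4 * of_real A * \<alpha>)) *
             (\<Sum>s\<in>{1, -1}. s ^ p\<^sub>z *
               ((\<Sum>m = 1..p\<^sub>z. of_nat (p\<^sub>z choose m) *
                    (of_real ((- \<eta>) ^ m) / \<alpha> powi (int m - int p\<^sub>z)) *
                    (2 / of_real (sqrt pi)) *
                    hermite (m - 1) (\<alpha> / of_real (2 * \<eta>) + s * of_real (\<eta> * R $ 3)) *
                    exp (- (\<alpha>\<^sup>2 / of_real (4 * \<eta>\<^sup>2)) - of_real (\<eta>\<^sup>2 * (R $ 3)\<^sup>2)))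
                + \<alpha> ^ p\<^sub>z * exp (s * \<alpha> * of_real (R $ 3)) *
                    erfc (\<alpha> / of_real (2 * \<eta>) + s * of_real (\<eta> * R $ 3)))))"
    (is "has_partial_derivs _ _ _ _ ?G")
proof -
  define X where "X = (\<lambda>a x. (\<i> * of_real (k $ 1)) ^ a * (exp (\<i> * of_real (k $ 1) * x) / (4 * of_real A * \<alpha>)))"
  define Z where "Z = (\<lambda>c z. \<Sum>s\<in>{1, -1}. (deriv ^^ c) (exp_erfc \<eta> \<alpha> s) z)"
  \<comment> \<open>The division by 1 matches the shape of
    \<open>has_field_derivative_exp_iterate\<close>.\<close>
  define W where "W = (\<lambda>b c y z. (\<i> * of_real (k $ 2)) ^ b * (exp (\<i> * of_real (k $ 2) * y) / 1) * Z c z)"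
  have "(Z c has_field_derivative Z (Suc c) z) (at z)" for c z
    unfolding Z_def
    by (intro DERIV_sum has_field_derivative_higher_deriv[OF holomorphic_exp_erfc[OF assms]]) auto
  then have "has_partial_derivs p\<^sub>x p\<^sub>y p\<^sub>z
           (\<lambda>R. X 0 (of_real (R $ 1)) * W 0 0 (of_real (R $ 2)) (of_real (R $ 3)))
           (\<lambda>R. X p\<^sub>x (of_real (R $ 1)) * W p\<^sub>y p\<^sub>z (of_real (R $ 2)) (of_real (R $ 3)))"
    unfolding X_def W_def
    by (intro has_partial_derivs_separable has_field_derivative_exp_iterate DERIV_cmult_right DERIV_cmult)
  moreover have "(\<lambda>R. X 0 (of_real (R $ 1)) * W 0 0 (of_real (R $ 2)) (of_real (R $ 3))) = ewald2 \<eta> A \<alpha> k"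
    by (simp add: fun_eq_iff ewald2_eq X_def W_def Z_def distrib_left exp_add mult_ac add_divide_distrib)
  moreover have "(\<lambda>R. X p\<^sub>x (of_real (R $ 1)) * W p\<^sub>y p\<^sub>z (of_real (R $ 2)) (of_real (R $ 3))) = ?G"
  proof
    fix R :: "real^3"
    let ?E = "exp (\<i> * of_real (k $ 1 * R $ 1 + k $ 2 * R $ 2)) / (4 * of_real A * \<alpha>)"
    have "X p\<^sub>x (of_real (R $ 1)) * W p\<^sub>y p\<^sub>z (of_real (R $ 2)) (of_real (R $ 3)) =
        (\<i> * of_real (k $ 1)) ^ p\<^sub>x * (\<i> * of_real (k $ 2)) ^ p\<^sub>y * ?E * Z p\<^sub>z (of_real (R $ 3))"
      by (simp add: X_def W_def distrib_left exp_add mult_ac)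
    also have "\<dots> = ?G R"
      unfolding Z_def by (intro arg_cong2[where f = "(*)"] sum.cong refl)
        (subst higher_deriv_exp_erfc[OF assms], auto)
    finally show "X p\<^sub>x (of_real (R $ 1)) * W p\<^sub>y p\<^sub>z (of_real (R $ 2)) (of_real (R $ 3)) = ?G R" .
  qed
  ultimately show ?thesis by simp
qed

section \<open>The three-dimensional term\<close>

lemma has_partial_derivs_ewald3:
  "has_partial_derivs p\<^sub>x p\<^sub>y p\<^sub>z (ewald3 \<eta> A \<alpha> k)
     (\<lambda>R. (\<i> * of_real (k $ 1)) ^ p\<^sub>x * (\<i> * of_real (k $ 2)) ^ p\<^sub>y * (\<i> * of_real (k $ 3)) ^ p\<^sub>z *
        (exp (\<i> * of_real (k \<bullet> R) - \<alpha>\<^sup>2 / of_real (4 * \<eta>\<^sup>2)) / (of_real A * \<alpha>\<^sup>2)))"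
    (is "has_partial_derivs _ _ _ _ ?G")
proof -
  \<comment> \<open>The constant Gaussian factor is moved into the denominator, leaving a product of
    pure exponentials in the three coordinates.\<close>
  define C where "C = of_real A * \<alpha>\<^sup>2 * exp (\<alpha>\<^sup>2 / of_real (4 * \<eta>\<^sup>2))"
  define X where "X = (\<lambda>a x. (\<i> * of_real (k $ 1)) ^ a * (exp (\<i> * of_real (k $ 1) * x) / C))"
  define W where "W = (\<lambda>b c y z. (\<i> * of_real (k $ 2)) ^ b * (exp (\<i> * of_real (k $ 2) * y) / 1) *
      ((\<i> * of_real (k $ 3)) ^ c * (exp (\<i> * of_real (k $ 3) * z) / 1)))"
  have eq: "exp (\<i> * of_real (k \<bullet> R) - \<alpha>\<^sup>2 / of_real (4 * \<eta>\<^sup>2)) / (of_real A * \<alpha>\<^sup>2) =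
     exp (\<i> * of_real (k $ 1) * of_real (R $ 1)) / C *
       (exp (\<i> * of_real (k $ 2) * of_real (R $ 2)) * exp (\<i> * of_real (k $ 3) * of_real (R $ 3)))" for R
    by (simp add: C_def inner_vec_def sum_3 exp_diff exp_add distrib_left mult_ac)
  have "has_partial_derivs p\<^sub>x p\<^sub>y p\<^sub>z
           (\<lambda>R. X 0 (of_real (R $ 1)) * W 0 0 (of_real (R $ 2)) (of_real (R $ 3)))
           (\<lambda>R. X p\<^sub>x (of_real (R $ 1)) * W p\<^sub>y p\<^sub>z (of_real (R $ 2)) (of_real (R $ 3)))"
    unfolding X_def W_def
    by (intro has_partial_derivs_separable has_field_derivative_exp_iterate DERIV_cmult_right DERIV_cmult)
  moreover have "(\<lambda>R. X 0 (of_real (R $ 1)) * W 0 0 (of_real (R $ 2)) (of_real (R $ 3))) = ewald3 \<eta> A \<alpha> k"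
    by (simp only: fun_eq_iff ewald3_def eq) (simp add: X_def W_def)
  moreover have "(\<lambda>R. X p\<^sub>x (of_real (R $ 1)) * W p\<^sub>y p\<^sub>z (of_real (R $ 2)) (of_real (R $ 3))) = ?G"
    by (simp only: fun_eq_iff eq) (simp add: X_def W_def mult_ac)
  ultimately show ?thesis by simp
qed

section \<open>The one-dimensional term\<close>

definition ewald1_coeff :: "int \<Rightarrow> real \<Rightarrow> complex \<Rightarrow> nat \<Rightarrow> complex" where
  "ewald1_coeff b \<eta> \<alpha> q =
     of_real ((- (\<eta>\<^sup>2)) ^ q / fact q) * expint b (1 + q) (\<alpha>\<^sup>2 / of_real (4 * \<eta>\<^sup>2))"

text \<open>As \<alpha> and \<eta> are nonzero, so is the argument of \<open>expint\<close>, and the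
  geometric bound in the order applies on every branch.\<close>

lemma ewald1_coeff_bound:
  assumes "\<eta> \<noteq> 0" "\<alpha> \<noteq> 0"
  obtains K D where "\<And>q. norm (ewald1_coeff b \<eta> \<alpha> q) \<le> K * D ^ q / fact q"
proof -
  have "\<alpha>\<^sup>2 / of_real (4 * \<eta>\<^sup>2) \<noteq> 0" using assms by simp
  then obtain C D where CD:
    "\<And>q. norm (expint b (Suc q) (\<alpha>\<^sup>2 / of_real (4 * \<eta>\<^sup>2))) \<le> C * D ^ q"
    by (rule expint_geometric_bound[where b = b]) blast
  have "norm (ewald1_coeff b \<eta> \<alpha> q) \<le> C * (\<eta>\<^sup>2 * D) ^ q / fact q" for q
  proof -
    have "norm (ewald1_coeff b \<eta> \<alpha> q)
            = (\<eta>\<^sup>2) ^ q / fact q * norm (expint b (Suc q) (\<alpha>\<^sup>2 / of_real (4 * \<eta>\<^sup>2)))"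
      unfolding ewald1_coeff_def norm_mult norm_of_real by (simp add: power_abs abs_mult)
    also have "\<dots> \<le> (\<eta>\<^sup>2) ^ q / fact q * (C * D ^ q)"
      by (intro mult_left_mono CD) simp
    finally show ?thesis by (simp add: power_mult_distrib mult_ac)
  qed
  then show ?thesis by (rule that)
qed

text \<open>The even power removes the square root, so each term is a polynomial in the transverse
  coordinates.\<close>

lemma ewald1_term_eq:
  "ewald1_term b \<eta> \<alpha> R q = ewald1_coeff b \<eta> \<alpha> q * radial_term_deriv 0 0 (of_real (R $ 2)) (of_real (R $ 3)) q"
proof -
  have "(\<eta> * sqrt ((R $ 2)\<^sup>2 + (R $ 3)\<^sup>2)) ^ (2 * q) = (\<eta>\<^sup>2) ^ q * ((R $ 2)\<^sup>2 + (R $ 3)\<^sup>2) ^ q"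
    by (simp add: power_mult power_mult_distrib)
  then have "ewald1_term b \<eta> \<alpha> R q = (-1) ^ q / fact q *
      of_real ((\<eta>\<^sup>2) ^ q * ((R $ 2)\<^sup>2 + (R $ 3)\<^sup>2) ^ q) * expint b (1 + q) (\<alpha>\<^sup>2 / of_real (4 * \<eta>\<^sup>2))"
    by (simp only: ewald1_term_def)
  then show ?thesis
    by (simp add: ewald1_coeff_def radial_term_deriv_0 power_minus[of "_\<^sup>2"] mult_ac)
qed

lemma monom_deriv_of_real:
  "monom_deriv a n (of_real y) =
     of_real (if a \<le> n then fact n / fact (n - a) * y ^ (n - a) else 0)"
proof (cases "a \<le> n")
  case True
  then show ?thesis by (simp add: monom_deriv_def binomial_fact)
qed (simp add: monom_deriv_def)

text \<open>Monomials of too low degree are annihilated by the differentiation, which accounts for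
  the restrictions on \<open>m\<close>.\<close>

lemma ewald1_deriv_term_eq:
  "ewald1_deriv_term b \<eta> \<alpha> p\<^sub>y p\<^sub>z R q =
     ewald1_coeff b \<eta> \<alpha> q * radial_term_deriv p\<^sub>y p\<^sub>z (of_real (R $ 2)) (of_real (R $ 3)) q"
proof -
  have "radial_term_deriv p\<^sub>y p\<^sub>z (of_real (R $ 2)) (of_real (R $ 3)) q =
      of_real (\<Sum>m\<le>q. real (q choose m) *
        ((if p\<^sub>y \<le> 2 * q - 2 * m then fact (2 * q - 2 * m) / fact (2 * q - 2 * m - p\<^sub>y) *
            (R $ 2) ^ (2 * q - 2 * m - p\<^sub>y) else 0) *
         (if p\<^sub>z \<le> 2 * m then fact (2 * m) / fact (2 * m - p\<^sub>z) * (R $ 3) ^ (2 * m - p\<^sub>z) else 0)))"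
    unfolding radial_term_deriv_def monom_deriv_of_real by simp
  also have "(\<Sum>m\<le>q. real (q choose m) *
        ((if p\<^sub>y \<le> 2 * q - 2 * m then fact (2 * q - 2 * m) / fact (2 * q - 2 * m - p\<^sub>y) *
            (R $ 2) ^ (2 * q - 2 * m - p\<^sub>y) else 0) *
         (if p\<^sub>z \<le> 2 * m then fact (2 * m) / fact (2 * m - p\<^sub>z) * (R $ 3) ^ (2 * m - p\<^sub>z) else 0))) =
      (\<Sum>m | m \<le> q \<and> p\<^sub>y \<le> 2 * q - 2 * m \<and> p\<^sub>z \<le> 2 * m.
        real (q choose m) * (fact (2 * q - 2 * m) * fact (2 * m)) /
          (fact (2 * q - 2 * m - p\<^sub>y) * fact (2 * m - p\<^sub>z)) *
        (R $ 2) ^ (2 * q - 2 * m - p\<^sub>y) * (R $ 3) ^ (2 * m - p\<^sub>z))"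
    by (rule sum.mono_neutral_cong_right) auto
  finally show ?thesis by (simp only: ewald1_deriv_term_def ewald1_coeff_def)
qed

lemma ewald1_summable_and_partial_derivs:
  assumes "\<eta> \<noteq> 0" "\<alpha> \<noteq> 0"
  shows summable_ewald1_term: "summable (ewald1_term b \<eta> \<alpha> R)"
    and summable_ewald1_deriv_term: "summable (ewald1_deriv_term b \<eta> \<alpha> p\<^sub>y p\<^sub>z R)"
    and has_partial_derivs_ewald1: "has_partial_derivs p\<^sub>x p\<^sub>y p\<^sub>z (ewald1 b \<eta> A \<alpha> k)
          (\<lambda>R. (\<i> * of_real (k $ 1)) ^ p\<^sub>x *
             (exp (\<i> * of_real (k $ 1 * R $ 1)) / of_real (4 * pi * A)) *
             (\<Sum>q. ewald1_deriv_term b \<eta> \<alpha> p\<^sub>y p\<^sub>z R q))"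
proof -
  obtain K D where KD: "\<And>q. norm (ewald1_coeff b \<eta> \<alpha> q) \<le> K * D ^ q / fact q"
    using ewald1_coeff_bound[OF assms] by blast
  have terms: "ewald1_term b \<eta> \<alpha> R = (\<lambda>q. ewald1_coeff b \<eta> \<alpha> q *
      radial_term_deriv 0 0 (of_real (R $ 2)) (of_real (R $ 3)) q)" for R
    by (rule ext) (rule ewald1_term_eq)
  show "summable (ewald1_term b \<eta> \<alpha> R)" "summable (ewald1_deriv_term b \<eta> \<alpha> p\<^sub>y p\<^sub>z R)"
    using summable_radial_series[OF KD]
    by (simp_all add: terms ewald1_deriv_term_eq[abs_def])
  define X where "X = (\<lambda>a x. (\<i> * of_real (k $ 1)) ^ a * (exp (\<i> * of_real (k $ 1) * x) / of_real (4 * pi * A)))"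
  define W where "W = (\<lambda>b' c y z. \<Sum>q. ewald1_coeff b \<eta> \<alpha> q * radial_term_deriv b' c y z q)"
  have "has_partial_derivs p\<^sub>x p\<^sub>y p\<^sub>z
           (\<lambda>R. X 0 (of_real (R $ 1)) * W 0 0 (of_real (R $ 2)) (of_real (R $ 3)))
           (\<lambda>R. X p\<^sub>x (of_real (R $ 1)) * W p\<^sub>y p\<^sub>z (of_real (R $ 2)) (of_real (R $ 3)))"
    unfolding X_def W_def
    by (intro has_partial_derivs_separable has_field_derivative_exp_iterate
          has_field_derivative_radial_series_1[OF KD] has_field_derivative_radial_series_2[OF KD])
  then show "has_partial_derivs p\<^sub>x p\<^sub>y p\<^sub>z (ewald1 b \<eta> A \<alpha> k)
          (\<lambda>R. (\<i> * of_real (k $ 1)) ^ p\<^sub>x *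
             (exp (\<i> * of_real (k $ 1 * R $ 1)) / of_real (4 * pi * A)) *
             (\<Sum>q. ewald1_deriv_term b \<eta> \<alpha> p\<^sub>y p\<^sub>z R q))"
    by (simp add: X_def W_def ewald1_def[abs_def] terms ewald1_deriv_term_eq mult.assoc)
qed

theorem mainTheorem2:
  fixes \<eta> A\<^sub>1 A\<^sub>2 A\<^sub>3 :: real and p\<^sub>x p\<^sub>y p\<^sub>z :: nat and L k :: "real^3" and \<alpha> :: complex and b :: int
  assumes "\<eta> > 0" and "A\<^sub>1 > 0" and "A\<^sub>2 > 0" and "A\<^sub>3 > 0" and "\<forall>i. L $ i > 0"
    and "ewald_alpha k \<alpha>" and "\<alpha> \<noteq> 0"
  shows
    "(k \<in> reciprocal_lattice 1 L \<longrightarrow>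
        (\<forall>R. summable (ewald1_term b \<eta> \<alpha> R)) \<and>
        (\<forall>R. summable (ewald1_deriv_term b \<eta> \<alpha> p\<^sub>y p\<^sub>z R)) \<and>
        has_partial_derivs p\<^sub>x p\<^sub>y p\<^sub>z (ewald1 b \<eta> A\<^sub>1 \<alpha> k)
          (\<lambda>R. (\<i> * of_real (k $ 1)) ^ p\<^sub>x *
             (exp (\<i> * of_real (k $ 1 * R $ 1)) / of_real (4 * pi * A\<^sub>1)) *
             (\<Sum>q. ewald1_deriv_term b \<eta> \<alpha> p\<^sub>y p\<^sub>z R q)))
   \<and> (k \<in> reciprocal_lattice 2 L \<longrightarrow>
        has_partial_derivs p\<^sub>x p\<^sub>y p\<^sub>z (ewald2 \<eta> A\<^sub>2 \<alpha> k)
          (\<lambda>R. (\<i> * of_real (k $ 1)) ^ p\<^sub>x * (\<i> * of_real (k $ 2)) ^ p\<^sub>y *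
             (exp (\<i> * of_real (k $ 1 * R $ 1 + k $ 2 * R $ 2)) / (4 * of_real A\<^sub>2 * \<alpha>)) *
             (\<Sum>s\<in>{1, -1}. s ^ p\<^sub>z *
               ((\<Sum>m = 1..p\<^sub>z. of_nat (p\<^sub>z choose m) *
                    (of_real ((- \<eta>) ^ m) / \<alpha> powi (int m - int p\<^sub>z)) *
                    (2 / of_real (sqrt pi)) *
                    hermite (m - 1) (\<alpha> / of_real (2 * \<eta>) + s * of_real (\<eta> * R $ 3)) *
                    exp (- (\<alpha>\<^sup>2 / of_real (4 * \<eta>\<^sup>2)) - of_real (\<eta>\<^sup>2 * (R $ 3)\<^sup>2)))
                + \<alpha> ^ p\<^sub>z * exp (s * \<alpha> * of_real (R $ 3)) *
                    erfc (\<alpha> / of_real (2 * \<eta>) + s * of_real (\<eta> * R $ 3))))))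
   \<and> (k \<in> reciprocal_lattice 3 L \<longrightarrow>
        has_partial_derivs p\<^sub>x p\<^sub>y p\<^sub>z (ewald3 \<eta> A\<^sub>3 \<alpha> k)
          (\<lambda>R. (\<i> * of_real (k $ 1)) ^ p\<^sub>x * (\<i> * of_real (k $ 2)) ^ p\<^sub>y *
             (\<i> * of_real (k $ 3)) ^ p\<^sub>z *
             (exp (\<i> * of_real (k \<bullet> R) - \<alpha>\<^sup>2 / of_real (4 * \<eta>\<^sup>2)) / (of_real A\<^sub>3 * \<alpha>\<^sup>2))))"
proof (intro conjI impI allI)
  have nz: "\<eta> \<noteq> 0" using assms(1) by simp
  show "summable (ewald1_term b \<eta> \<alpha> R)" for R
    by (rule summable_ewald1_term[OF nz assms(7)])
  show "summable (ewald1_deriv_term b \<eta> \<alpha> p\<^sub>y p\<^sub>z R)" for R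
    by (rule summable_ewald1_deriv_term[OF nz assms(7)])
qed (rule has_partial_derivs_ewald1 has_partial_derivs_ewald2 has_partial_derivs_ewald3;
     use assms in simp)+

end
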